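(* Let $\mathcal B$ be any reflective subcategory of $\mathcal X$. Let $\mathcal A$ be an extremally epireflective subcategory of $\mathcal X$, with $\mathcal A$-reflection morphisms $r_X$, satisfying the following condition: ( * ) whenever $X$ is an object of $\mathcal X$ which is not an object of $\mathcal A$, there exist morphisms $f,g:Z\to X$ such that $f\ne g$ and $r_X\cdot f=r_X\cdot g$, and a morphism $\overline g:X\to Z$ such that $\overline g\cdot g=\overline g\cdot f$ and $g\cdot\overline g\cdot g=g$. If $\mathcal A$ and $\mathcal B$ induce the same regular closure operators (up to isomorphism; i.e. $c_{\mathcal A}(m)\cong c_{\mathcal B}(m)$ for all $m\in\mathcal M$), then $\mathcal B\subseteq\mathcal A$.
   Context: Subcategories are always full and isomorphism-closed. $\mathcal X$ is a category with a fixed class $\mathcal M$ of morphisms containing all isomorphisms. $\mathcal X$ is $\mathcal M$-complete: $\mathcal M$ is closed under composition; pullbacks of $\mathcal M$-morphisms exist and belong to $\mathcal M$; multiple pullbacks of (possibly large) families of $\mathcal M$-morphisms with common codomain exist and belong to $\mathcal M$. Consequently every morphism in $\mathcal M$ is a monomorphism, and for each object $X$ the class $\mathcal M/X$ of $\mathcal M$-morphisms with codomain $X$ is a (possibly large) complete preordered class ($m\le n$ iff $m = n\cdot k$ for some $k$); $\cong$ denotes equivalence in this preorder. Moreover $\mathcal X$ has equalizers, cokernel pairs and finite products, and $\mathcal M$ contains all regular monomorphisms of $\mathcal X$. For a subcategory $\mathcal A$, a morphism is an $\mathcal A$-regular monomorphism if it is the equalizer of two morphisms $h,k : Y\to A$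 with $A\in\mathcal A$. The regular closure operator induced by $\mathcal A$ is $c_{\mathcal A}(m)=\bigwedge\{r\in\mathcal M \mid r\ge m,\ r \text{ is } \mathcal A\text{-regular}\}$ for $m \in \mathcal M/X$ (meet in $\mathcal M/X$). $\mathcal A$ is extremally epireflective in $\mathcal X$ if it is reflective and all reflection morphisms are extremal epimorphisms. *)

theory Defs
  imports Main
begin

record ('o, 'a) cat =
  Obj :: "'o set"
  Arr :: "'a set"
  Dom :: "'a \<Rightarrow> 'o"
  Cod :: "'a \<Rightarrow> 'o"
  Id :: "'o \<Rightarrow> 'a"
  comp :: "'a \<Rightarrow> 'a \<Rightarrow> 'a"  (infixr "\<cdot>\<index>" 70)

definition hom :: "('o, 'a) cat \<Rightarrow> 'o \<Rightarrow> 'o \<Rightarrow> 'a set" where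
  "hom C X Y = {f \<in> Arr C. Dom C f = X \<and> Cod C f = Y}"

text \<open>Composition is written in the order of application: \<open>g \<cdot> f\<close> is first \<open>f\<close>, then \<open>g\<close>.
  It is unspecified for arrows that are not composable.  Classes of objects or arrows, small or
  large, are rendered as sets over the types \<open>'o\<close> and \<open>'a\<close>.\<close>

locale category =
  fixes C :: "('o, 'a) cat" (structure)
  assumes Dom_Obj: "f \<in> Arr C \<Longrightarrow> Dom C f \<in> Obj C"
    and Cod_Obj: "f \<in> Arr C \<Longrightarrow> Cod C f \<in> Obj C"
    and Id_hom: "X \<in> Obj C \<Longrightarrow> Id C X \<in> hom C X X"
    and comp_hom: "f \<in> hom C X Y \<Longrightarrow> g \<in> hom C Y Z \<Longrightarrow> g \<cdot> f \<in> hom C X Z"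
    and comp_Id: "f \<in> hom C X Y \<Longrightarrow> f \<cdot> Id C X = f"
    and Id_comp: "f \<in> hom C X Y \<Longrightarrow> Id C Y \<cdot> f = f"
    and comp_assoc: "f \<in> hom C W X \<Longrightarrow> g \<in> hom C X Y \<Longrightarrow> h \<in> hom C Y Z \<Longrightarrow>
      (h \<cdot> g) \<cdot> f = h \<cdot> (g \<cdot> f)"

definition isomorphism :: "('o, 'a) cat \<Rightarrow> 'a \<Rightarrow> bool" where
  "isomorphism C f \<longleftrightarrow> f \<in> Arr C \<and>
    (\<exists>g \<in> hom C (Cod C f) (Dom C f).
      g \<cdot>\<^bsub>C\<^esub> f = Id C (Dom C f) \<and> f \<cdot>\<^bsub>C\<^esub> g = Id C (Cod C f))"

definition monomorphism :: "('o, 'a) cat \<Rightarrow> 'a \<Rightarrow> bool" where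
  "monomorphism C m \<longleftrightarrow> m \<in> Arr C \<and>
    (\<forall>Z. \<forall>f \<in> hom C Z (Dom C m). \<forall>g \<in> hom C Z (Dom C m).
      m \<cdot>\<^bsub>C\<^esub> f = m \<cdot>\<^bsub>C\<^esub> g \<longrightarrow> f = g)"

definition epimorphism :: "('o, 'a) cat \<Rightarrow> 'a \<Rightarrow> bool" where
  "epimorphism C e \<longleftrightarrow> e \<in> Arr C \<and>
    (\<forall>Z. \<forall>f \<in> hom C (Cod C e) Z. \<forall>g \<in> hom C (Cod C e) Z.
      f \<cdot>\<^bsub>C\<^esub> e = g \<cdot>\<^bsub>C\<^esub> e \<longrightarrow> f = g)"

definition extremal_epimorphism :: "('o, 'a) cat \<Rightarrow> 'a \<Rightarrow> bool" where
  "extremal_epimorphism C e \<longleftrightarrow> epimorphism C e \<and>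
    (\<forall>Y m g. monomorphism C m \<and> m \<in> hom C Y (Cod C e) \<and> g \<in> hom C (Dom C e) Y \<and>
      e = m \<cdot>\<^bsub>C\<^esub> g \<longrightarrow> isomorphism C m)"

definition is_equalizer :: "('o, 'a) cat \<Rightarrow> 'a \<Rightarrow> 'a \<Rightarrow> 'a \<Rightarrow> bool" where
  "is_equalizer C h k e \<longleftrightarrow> (\<exists>E X Y. e \<in> hom C E X \<and> h \<in> hom C X Y \<and> k \<in> hom C X Y \<and>
    h \<cdot>\<^bsub>C\<^esub> e = k \<cdot>\<^bsub>C\<^esub> e \<and>
    (\<forall>Z. \<forall>f \<in> hom C Z X. h \<cdot>\<^bsub>C\<^esub> f = k \<cdot>\<^bsub>C\<^esub> f \<longrightarrow>
      (\<exists>!u. u \<in> hom C Z E \<and> e \<cdot>\<^bsub>C\<^esub> u = f)))"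

definition regular_monomorphism :: "('o, 'a) cat \<Rightarrow> 'a \<Rightarrow> bool" where
  "regular_monomorphism C e \<longleftrightarrow> (\<exists>h k. is_equalizer C h k e)"

text \<open>The pair \<open>i, j\<close> is a cokernel pair of \<open>f\<close>, that is, a pushout of \<open>f\<close> with itself.\<close>

definition is_cokernel_pair :: "('o, 'a) cat \<Rightarrow> 'a \<Rightarrow> 'a \<Rightarrow> 'a \<Rightarrow> bool" where
  "is_cokernel_pair C f i j \<longleftrightarrow> (\<exists>X Y Q. f \<in> hom C X Y \<and> i \<in> hom C Y Q \<and> j \<in> hom C Y Q \<and>
    i \<cdot>\<^bsub>C\<^esub> f = j \<cdot>\<^bsub>C\<^esub> f \<and>
    (\<forall>Z. \<forall>u \<in> hom C Y Z. \<forall>v \<in> hom C Y Z. u \<cdot>\<^bsub>C\<^esub> f = v \<cdot>\<^bsub>C\<^esub> f \<longrightarrow>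
      (\<exists>!w. w \<in> hom C Q Z \<and> w \<cdot>\<^bsub>C\<^esub> i = u \<and> w \<cdot>\<^bsub>C\<^esub> j = v)))"

definition is_product :: "('o, 'a) cat \<Rightarrow> 'i set \<Rightarrow> ('i \<Rightarrow> 'o) \<Rightarrow> 'o \<Rightarrow> ('i \<Rightarrow> 'a) \<Rightarrow> bool" where
  "is_product C I X P p \<longleftrightarrow> P \<in> Obj C \<and> (\<forall>i \<in> I. p i \<in> hom C P (X i)) \<and>
    (\<forall>Q \<in> Obj C. \<forall>q. (\<forall>i \<in> I. q i \<in> hom C Q (X i)) \<longrightarrow>
      (\<exists>!u. u \<in> hom C Q P \<and> (\<forall>i \<in> I. p i \<cdot>\<^bsub>C\<^esub> u = q i)))"

text \<open>In \<open>is_pullback C f m n g\<close>, the arrow \<open>n\<close> is the pullback of \<open>m\<close> along \<open>f\<close>: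
  the pullback square is \<open>f \<cdot> n = m \<cdot> g\<close>.\<close>

definition is_pullback :: "('o, 'a) cat \<Rightarrow> 'a \<Rightarrow> 'a \<Rightarrow> 'a \<Rightarrow> 'a \<Rightarrow> bool" where
  "is_pullback C f m n g \<longleftrightarrow> (\<exists>X Y M P. f \<in> hom C X Y \<and> m \<in> hom C M Y \<and>
    n \<in> hom C P X \<and> g \<in> hom C P M \<and> f \<cdot>\<^bsub>C\<^esub> n = m \<cdot>\<^bsub>C\<^esub> g \<and>
    (\<forall>Z. \<forall>u \<in> hom C Z X. \<forall>v \<in> hom C Z M. f \<cdot>\<^bsub>C\<^esub> u = m \<cdot>\<^bsub>C\<^esub> v \<longrightarrow>
      (\<exists>!w. w \<in> hom C Z P \<and> n \<cdot>\<^bsub>C\<^esub> w = u \<and> g \<cdot>\<^bsub>C\<^esub> w = v)))"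

text \<open>The arrow \<open>d\<close>, with projections \<open>p i\<close>, is a multiple pullback of the family of arrows
  \<open>m i\<close> (\<open>i \<in> I\<close>) with common codomain \<open>X\<close>; it is the diagonal \<open>d = m i \<cdot> p i\<close>.\<close>

definition is_multiple_pullback ::
    "('o, 'a) cat \<Rightarrow> 'o \<Rightarrow> 'i set \<Rightarrow> ('i \<Rightarrow> 'a) \<Rightarrow> 'a \<Rightarrow> ('i \<Rightarrow> 'a) \<Rightarrow> bool" where
  "is_multiple_pullback C X I m d p \<longleftrightarrow> (\<exists>P. d \<in> hom C P X \<and>
    (\<forall>i \<in> I. m i \<in> Arr C \<and> Cod C (m i) = X \<and>
      p i \<in> hom C P (Dom C (m i)) \<and> m i \<cdot>\<^bsub>C\<^esub> p i = d) \<and>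
    (\<forall>Q q. \<forall>e \<in> hom C Q X.
      (\<forall>i \<in> I. q i \<in> hom C Q (Dom C (m i)) \<and> m i \<cdot>\<^bsub>C\<^esub> q i = e) \<longrightarrow>
      (\<exists>!u. u \<in> hom C Q P \<and> d \<cdot>\<^bsub>C\<^esub> u = e \<and> (\<forall>i \<in> I. p i \<cdot>\<^bsub>C\<^esub> u = q i))))"

text \<open>Possibly large families are indexed by arbitrary sets over the type of arrows.  This already
  forces every arrow of \<open>\<M>\<close> to be a monomorphism (consider constant families indexed by all arrows),
  so that repetitions in a family are immaterial and larger index sets would add nothing.\<close>

locale M_complete_category = category C
  for C :: "('o, 'a) cat" (structure) +
  fixes \<M> :: "'a set"
  assumes M_Arr: "\<M> \<subseteq> Arr C"
    and M_iso: "isomorphism C f \<Longrightarrow> f \<in> \<M>"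
    and M_comp: "m \<in> \<M> \<Longrightarrow> n \<in> \<M> \<Longrightarrow> Cod C m = Dom C n \<Longrightarrow> n \<cdot> m \<in> \<M>"
    and M_pullback_exists: "m \<in> \<M> \<Longrightarrow> f \<in> Arr C \<Longrightarrow> Cod C f = Cod C m \<Longrightarrow>
      \<exists>n g. is_pullback C f m n g"
    and M_pullback_stable: "m \<in> \<M> \<Longrightarrow> is_pullback C f m n g \<Longrightarrow> n \<in> \<M>"
    and M_multiple_pullback_exists: "X \<in> Obj C \<Longrightarrow>
      (\<And>i. i \<in> (I :: 'a set) \<Longrightarrow> F i \<in> \<M> \<and> Cod C (F i) = X) \<Longrightarrow>
      \<exists>d p. is_multiple_pullback C X I F d p"
    and M_multiple_pullback_closed:
      "(\<And>i. i \<in> (I :: 'a set) \<Longrightarrow> F i \<in> \<M>) \<Longrightarrow> is_multiple_pullback C X I F d p \<Longrightarrow> d \<in> \<M>"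

locale regular_closure_setting = M_complete_category C \<M>
  for C :: "('o, 'a) cat" (structure) and \<M> :: "'a set" +
  assumes equalizers: "h \<in> hom C X Y \<Longrightarrow> k \<in> hom C X Y \<Longrightarrow> \<exists>e. is_equalizer C h k e"
    and cokernel_pairs: "f \<in> Arr C \<Longrightarrow> \<exists>i j. is_cokernel_pair C f i j"
    and finite_products: "finite (I :: nat set) \<Longrightarrow> (\<And>i. i \<in> I \<Longrightarrow> F i \<in> Obj C) \<Longrightarrow>
      \<exists>P p. is_product C I F P p"
    and regular_M: "regular_monomorphism C e \<Longrightarrow> e \<in> \<M>"

definition sub_le :: "('o, 'a) cat \<Rightarrow> 'a \<Rightarrow> 'a \<Rightarrow> bool" where
  "sub_le C m n \<longleftrightarrow> m \<in> Arr C \<and> n \<in> Arr C \<and> Cod C m = Cod C n \<and>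
    (\<exists>k \<in> hom C (Dom C m) (Dom C n). m = n \<cdot>\<^bsub>C\<^esub> k)"

definition sub_equiv :: "('o, 'a) cat \<Rightarrow> 'a \<Rightarrow> 'a \<Rightarrow> bool" where
  "sub_equiv C m n \<longleftrightarrow> sub_le C m n \<and> sub_le C n m"

definition is_meet :: "('o, 'a) cat \<Rightarrow> 'a set \<Rightarrow> 'o \<Rightarrow> 'a set \<Rightarrow> 'a \<Rightarrow> bool" where
  "is_meet C \<M> X S c \<longleftrightarrow> c \<in> \<M> \<and> Cod C c = X \<and> (\<forall>s \<in> S. sub_le C c s) \<and>
    (\<forall>d \<in> \<M>. Cod C d = X \<longrightarrow> (\<forall>s \<in> S. sub_le C d s) \<longrightarrow> sub_le C d c)"

text \<open>Subcategories are full, hence given by their classes of objects, and closed under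
  isomorphism.\<close>

definition subcategory :: "('o, 'a) cat \<Rightarrow> 'o set \<Rightarrow> bool" where
  "subcategory C \<A> \<longleftrightarrow> \<A> \<subseteq> Obj C \<and> (\<forall>f. isomorphism C f \<longrightarrow> Dom C f \<in> \<A> \<longrightarrow> Cod C f \<in> \<A>)"

definition is_reflection :: "('o, 'a) cat \<Rightarrow> 'o set \<Rightarrow> 'o \<Rightarrow> 'a \<Rightarrow> bool" where
  "is_reflection C \<A> X r \<longleftrightarrow> (\<exists>R \<in> \<A>. r \<in> hom C X R \<and>
    (\<forall>A \<in> \<A>. \<forall>f \<in> hom C X A. \<exists>!u. u \<in> hom C R A \<and> u \<cdot>\<^bsub>C\<^esub> r = f))"

definition reflective :: "('o, 'a) cat \<Rightarrow> 'o set \<Rightarrow> bool" where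
  "reflective C \<A> \<longleftrightarrow> subcategory C \<A> \<and> (\<forall>X \<in> Obj C. \<exists>r. is_reflection C \<A> X r)"

definition extremally_epireflective :: "('o, 'a) cat \<Rightarrow> 'o set \<Rightarrow> bool" where
  "extremally_epireflective C \<A> \<longleftrightarrow> reflective C \<A> \<and>
    (\<forall>X \<in> Obj C. \<forall>r. is_reflection C \<A> X r \<longrightarrow> extremal_epimorphism C r)"

definition regular_mono_wrt :: "('o, 'a) cat \<Rightarrow> 'o set \<Rightarrow> 'a \<Rightarrow> bool" where
  "regular_mono_wrt C \<A> e \<longleftrightarrow>
    (\<exists>Y. \<exists>A \<in> \<A>. \<exists>h \<in> hom C Y A. \<exists>k \<in> hom C Y A. is_equalizer C h k e)"

text \<open>The regular closure of \<open>m\<close> induced by \<open>\<A>\<close> is a meet in the preordered class of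
  \<open>\<M>\<close>-morphisms into the codomain of \<open>m\<close>; being determined only up to equivalence there,
  one such meet is chosen.\<close>

definition regular_closure :: "('o, 'a) cat \<Rightarrow> 'a set \<Rightarrow> 'o set \<Rightarrow> 'a \<Rightarrow> 'a" where
  "regular_closure C \<M> \<A> m =
    (SOME c. is_meet C \<M> (Cod C m) {r \<in> \<M>. sub_le C m r \<and> regular_mono_wrt C \<A> r} c)"

lemma (in M_complete_category) multiple_pullback_is_meet:
  assumes "\<And>s. s \<in> S \<Longrightarrow> s \<in> \<M>" and mp: "is_multiple_pullback C X S (\<lambda>s. s) d p"
  shows "is_meet C \<M> X S d"
proof -
  from mp obtain P where d: "d \<in> hom C P X"
    and p: "\<And>s. s \<in> S \<Longrightarrow> s \<in> Arr C \<and> Cod C s = X \<and> p s \<in> hom C P (Dom C s) \<and> s \<cdot> p s = d"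
    and U: "\<And>Q q e. e \<in> hom C Q X \<Longrightarrow> (\<And>s. s \<in> S \<Longrightarrow> q s \<in> hom C Q (Dom C s) \<and> s \<cdot> q s = e)
      \<Longrightarrow> \<exists>u. u \<in> hom C Q P \<and> d \<cdot> u = e"
    unfolding is_multiple_pullback_def by metis
  have dM: "d \<in> \<M>" using M_multiple_pullback_closed[OF _ mp] assms(1) by blast
  have le: "sub_le C d s" if "s \<in> S" for s
    using p[OF that] d by (auto simp: sub_le_def hom_def)
  have "sub_le C e d" if e: "e \<in> \<M>" "Cod C e = X" and le: "\<forall>s \<in> S. sub_le C e s" for e
  proof -
    obtain q where "\<And>s. s \<in> S \<Longrightarrow> q s \<in> hom C (Dom C e) (Dom C s) \<and> s \<cdot> q s = e"
      using le unfolding sub_le_def by metis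
    moreover have "e \<in> hom C (Dom C e) X" using e M_Arr by (auto simp: hom_def)
    ultimately obtain u where "u \<in> hom C (Dom C e) P" "d \<cdot> u = e" using U by blast
    then show ?thesis using d e M_Arr by (auto simp: sub_le_def hom_def)
  qed
  then show ?thesis using d dM le by (auto simp: is_meet_def hom_def)
qed

lemma (in M_complete_category) regular_closure_is_meet:
  assumes "m \<in> \<M>"
  shows "is_meet C \<M> (Cod C m) {r \<in> \<M>. sub_le C m r \<and> regular_mono_wrt C \<A> r}
    (regular_closure C \<M> \<A> m)"
proof -
  let ?S = "{r \<in> \<M>. sub_le C m r \<and> regular_mono_wrt C \<A> r}"
  have "\<exists>d p. is_multiple_pullback C (Cod C m) ?S (\<lambda>s. s) d p"
    by (rule M_multiple_pullback_exists) (use assms M_Arr Cod_Obj in \<open>auto simp: sub_le_def\<close>)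
  then have "\<exists>c. is_meet C \<M> (Cod C m) ?S c"
    using multiple_pullback_is_meet[of ?S] by blast
  then show ?thesis unfolding regular_closure_def by (rule someI_ex)
qed

end

theory Submission
  imports Defs
begin

text \<open>Suppose that an object \<open>X\<close> of \<open>\<B>\<close> is not in \<open>\<A>\<close>, and let \<open>f\<close>, \<open>g\<close> and \<open>gbar\<close> be as in the
  condition on such objects.  Then \<open>e = g \<cdot> gbar\<close> is an endomorphism of \<open>X\<close> that fixes \<open>g\<close> and sends
  \<open>f\<close> to \<open>g\<close>.  Its fixed-point subobject, the equalizer \<open>m\<close> of \<open>e\<close> and the identity of \<open>X\<close>,
  therefore contains \<open>g\<close> but not \<open>f\<close>.

  The two closure operators see \<open>m\<close> differently.  Since \<open>X\<close> lies in \<open>\<B>\<close>, the subobject \<open>m\<close> is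
  \<open>\<B>\<close>-regular, hence \<open>\<B>\<close>-closed (\<open>regular_closure_le_regular\<close>).  The closure induced by \<open>\<A>\<close>,
  on the other hand, cannot separate arrows that are identified by the reflection into \<open>\<A>\<close>:
  since \<open>r X \<cdot> f = r X \<cdot> g\<close> and \<open>g\<close> factors through \<open>m\<close>, the arrow \<open>f\<close> factors through the
  \<open>\<A>\<close>-closure of \<open>m\<close> (\<open>identified_by_reflection_le_regular_closure\<close>).  If the closures agree, then
  \<open>f\<close> factors through \<open>m\<close>, a contradiction.

  The relation \<open>sub_le\<close> makes sense for arbitrary arrows with a common codomain, and is used below
  to say that an arrow factors through another one.\<close>

lemma (in category) sub_le_trans:
  assumes "sub_le C f m" and "sub_le C m n"
  shows "sub_le C f n"
proof -
  from assms obtain k l where f: "f = m \<cdot> k" and k: "k \<in> hom C (Dom C f) (Dom C m)"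
    and m: "m = n \<cdot> l" and l: "l \<in> hom C (Dom C m) (Dom C n)"
    and arr: "f \<in> Arr C" "n \<in> Arr C" "Cod C f = Cod C n"
    unfolding sub_le_def by auto
  have "n \<in> hom C (Dom C n) (Cod C n)" using arr by (simp add: hom_def)
  then have "f = n \<cdot> (l \<cdot> k)" using comp_assoc[OF k l] f m by metis
  then show ?thesis using comp_hom[OF k l] arr by (auto simp: sub_le_def)
qed

lemma (in category) sub_le_equalizer_iff:
  assumes e: "is_equalizer C h k e" and f: "f \<in> Arr C" "Cod C f = Cod C e"
  shows "sub_le C f e \<longleftrightarrow> h \<cdot> f = k \<cdot> f"
proof -
  from e obtain E X Y where eh: "e \<in> hom C E X" and h: "h \<in> hom C X Y" and k: "k \<in> hom C X Y"
    and eq: "h \<cdot> e = k \<cdot> e"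
    and univ: "\<And>Z f. f \<in> hom C Z X \<Longrightarrow> h \<cdot> f = k \<cdot> f \<Longrightarrow> \<exists>u. u \<in> hom C Z E \<and> e \<cdot> u = f"
    unfolding is_equalizer_def by metis
  have fh: "f \<in> hom C (Dom C f) X" using f eh by (simp add: hom_def)
  show ?thesis
  proof
    assume "sub_le C f e"
    then obtain u where u: "u \<in> hom C (Dom C f) E" "f = e \<cdot> u"
      using eh by (auto simp: sub_le_def hom_def)
    then show "h \<cdot> f = k \<cdot> f"
      using comp_assoc[OF u(1) eh h] comp_assoc[OF u(1) eh k] eq by simp
  next
    assume "h \<cdot> f = k \<cdot> f"
    then show "sub_le C f e" using univ[OF fh] f eh by (force simp: sub_le_def hom_def)
  qed
qed

text \<open>A meet is defined by comparison with arrows of \<open>\<M>\<close> only, but it bounds every arrow: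
  it is equivalent to a multiple pullback, whose universal property concerns arbitrary arrows.\<close>

lemma (in M_complete_category) sub_le_meet:
  assumes meet: "is_meet C \<M> X S c" and S: "\<And>s. s \<in> S \<Longrightarrow> s \<in> \<M> \<and> Cod C s = X"
    and f: "f \<in> Arr C" "Cod C f = X" and le: "\<And>s. s \<in> S \<Longrightarrow> sub_le C f s"
  shows "sub_le C f c"
proof -
  have "X \<in> Obj C" using f Cod_Obj by blast
  then obtain d p where mp: "is_multiple_pullback C X S (\<lambda>s. s) d p"
    using M_multiple_pullback_exists[of X S "\<lambda>s. s"] S by blast
  then have "is_meet C \<M> X S d" using multiple_pullback_is_meet S by blast
  then have "sub_le C d c" using meet unfolding is_meet_def by blast
  moreover have "sub_le C f d"
  proof -
    from mp obtain P where d: "d \<in> hom C P X"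
      and univ: "\<And>Q q e. e \<in> hom C Q X \<Longrightarrow>
        (\<And>s. s \<in> S \<Longrightarrow> q s \<in> hom C Q (Dom C s) \<and> s \<cdot> q s = e) \<Longrightarrow>
        \<exists>u. u \<in> hom C Q P \<and> d \<cdot> u = e"
      unfolding is_multiple_pullback_def by metis
    obtain q where "\<And>s. s \<in> S \<Longrightarrow> q s \<in> hom C (Dom C f) (Dom C s) \<and> s \<cdot> q s = f"
      using le unfolding sub_le_def by metis
    moreover have "f \<in> hom C (Dom C f) X" using f by (simp add: hom_def)
    ultimately obtain u where "u \<in> hom C (Dom C f) P" "d \<cdot> u = f" using univ by blast
    then show ?thesis using d f by (auto simp: sub_le_def hom_def)
  qed
  ultimately show ?thesis using sub_le_trans by blast
qed

lemma (in M_complete_category) regular_closure_le_regular: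
  assumes m: "m \<in> \<M>" and n: "n \<in> \<M>" "sub_le C m n" "regular_mono_wrt C \<A> n"
  shows "sub_le C (regular_closure C \<M> \<A> m) n"
  using regular_closure_is_meet[OF m, of \<A>] n unfolding is_meet_def by blast

text \<open>Arrows into an object of \<open>\<A>\<close> factor through the reflection, so they cannot distinguish
  \<open>f\<close> from \<open>g\<close>.  Hence an \<open>\<A>\<close>-regular subobject contains \<open>f\<close> as soon as it contains \<open>g\<close>.\<close>

lemma (in category) identified_by_reflection_le_regular_mono:
  assumes r: "is_reflection C \<A> X r" and f: "f \<in> hom C Z X" and g: "g \<in> hom C Z X"
    and id: "r \<cdot> f = r \<cdot> g" and n: "regular_mono_wrt C \<A> n" and gn: "sub_le C g n"
  shows "sub_le C f n"
proof -
  obtain Y A h k where A: "A \<in> \<A>" and h: "h \<in> hom C Y A" and k: "k \<in> hom C Y A"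
    and eq: "is_equalizer C h k n"
    using n unfolding regular_mono_wrt_def by blast
  have cod: "Cod C n = X" using gn g by (auto simp: sub_le_def hom_def)
  have YX: "Y = X" using eq h cod unfolding is_equalizer_def hom_def by auto
  have same: "l \<cdot> f = l \<cdot> g" if l: "l \<in> hom C X A" for l
  proof -
    obtain R u where rh: "r \<in> hom C X R" and u: "u \<in> hom C R A" "u \<cdot> r = l"
      using r A l unfolding is_reflection_def by blast
    show ?thesis using comp_assoc[OF f rh u(1)] comp_assoc[OF g rh u(1)] u(2) id by simp
  qed
  have "h \<cdot> g = k \<cdot> g" using sub_le_equalizer_iff[OF eq] gn g cod by (auto simp: hom_def)
  then have "h \<cdot> f = k \<cdot> f" using same h k YX by simp
  then show ?thesis using sub_le_equalizer_iff[OF eq] f cod by (auto simp: hom_def)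
qed

lemma (in M_complete_category) identified_by_reflection_le_regular_closure:
  assumes r: "is_reflection C \<A> X r" and f: "f \<in> hom C Z X" and g: "g \<in> hom C Z X"
    and id: "r \<cdot> f = r \<cdot> g" and m: "m \<in> \<M>" and gm: "sub_le C g m"
  shows "sub_le C f (regular_closure C \<M> \<A> m)"
proof (rule sub_le_meet[OF regular_closure_is_meet[OF m]])
  have "Cod C m = X" using gm g by (auto simp: sub_le_def hom_def)
  then show "f \<in> Arr C" "Cod C f = Cod C m" using f by (auto simp: hom_def)
next
  fix s assume s: "s \<in> {n \<in> \<M>. sub_le C m n \<and> regular_mono_wrt C \<A> n}"
  then show "s \<in> \<M> \<and> Cod C s = Cod C m" by (auto simp: sub_le_def)
  have "sub_le C g s" using sub_le_trans[OF gm] s by blast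
  then show "sub_le C f s"
    using identified_by_reflection_le_regular_mono[OF r f g id] s by blast
qed

theorem theorem4p6:
  fixes C :: "('o, 'a) cat" (structure)
    and \<M> :: "'a set" and \<A> \<B> :: "'o set" and r :: "'o \<Rightarrow> 'a"
  assumes setting: "regular_closure_setting C \<M>"
    and B: "reflective C \<B>"
    and A: "extremally_epireflective C \<A>"
    and r: "\<And>X. X \<in> Obj C \<Longrightarrow> is_reflection C \<A> X (r X)"
    and star: "\<And>X. X \<in> Obj C \<Longrightarrow> X \<notin> \<A> \<Longrightarrow>
      \<exists>Z. \<exists>f \<in> hom C Z X. \<exists>g \<in> hom C Z X.
        f \<noteq> g \<and> r X \<cdot> f = r X \<cdot> g \<and>
        (\<exists>gbar \<in> hom C X Z. gbar \<cdot> g = gbar \<cdot> f \<and> g \<cdot> gbar \<cdot> g = g)"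
    and same: "\<And>m. m \<in> \<M> \<Longrightarrow>
      sub_equiv C (regular_closure C \<M> \<A> m) (regular_closure C \<M> \<B> m)"
  shows "\<B> \<subseteq> \<A>"
proof
  interpret regular_closure_setting C \<M> by (rule setting)
  fix X assume XB: "X \<in> \<B>"
  then have X: "X \<in> Obj C" using B unfolding reflective_def subcategory_def by blast
  show "X \<in> \<A>"
  proof (rule ccontr)
    assume "X \<notin> \<A>"
    then obtain Z f g gbar where f: "f \<in> hom C Z X" and g: "g \<in> hom C Z X" and ne: "f \<noteq> g"
      and id: "r X \<cdot> f = r X \<cdot> g" and gbar: "gbar \<in> hom C X Z"
      and gbar_f: "gbar \<cdot> g = gbar \<cdot> f" and split: "g \<cdot> gbar \<cdot> g = g"
      using star[OF X] by blast
    let ?e = "g \<cdot> gbar"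
    have e: "?e \<in> hom C X X" using comp_hom[OF gbar g] .
    have eg: "?e \<cdot> g = g" using comp_assoc[OF g gbar g] split by simp
    have ef: "?e \<cdot> f = g" using comp_assoc[OF f gbar g] gbar_f split by simp
    obtain m where m: "is_equalizer C ?e (Id C X) m" using equalizers[OF e Id_hom[OF X]] by blast
    have mM: "m \<in> \<M>" using m regular_M unfolding regular_monomorphism_def by blast
    have cod: "Cod C m = X" using m e unfolding is_equalizer_def hom_def by auto
    have fixed: "sub_le C x m \<longleftrightarrow> ?e \<cdot> x = x" if "x \<in> hom C Y X" for x Y
      using sub_le_equalizer_iff[OF m] that cod Id_comp[OF that] by (auto simp: hom_def)
    have "sub_le C f (regular_closure C \<M> \<A> m)"
      using identified_by_reflection_le_regular_closure[OF r[OF X] f g id mM] fixed[OF g] eg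
      by blast
    moreover have "sub_le C (regular_closure C \<M> \<A> m) (regular_closure C \<M> \<B> m)"
      using same[OF mM] unfolding sub_equiv_def by blast
    moreover have "sub_le C (regular_closure C \<M> \<B> m) m"
    proof (rule regular_closure_le_regular[OF mM mM])
      have m_hom: "m \<in> hom C (Dom C m) (Cod C m)" using mM M_Arr by (auto simp: hom_def)
      then have "Dom C m \<in> Obj C" using Dom_Obj unfolding hom_def by blast
      then show "sub_le C m m"
        using m_hom comp_Id[OF m_hom] Id_hom by (force simp: sub_le_def hom_def)
      show "regular_mono_wrt C \<B> m"
        using m XB e Id_hom[OF X] unfolding regular_mono_wrt_def by blast
    qed
    ultimately have "sub_le C f m" using sub_le_trans by blast
    then show False using fixed[OF f] ef ne by simp
  qed
qed

end
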